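(* The algorithm \textsc{Perfectly Well-VE-Dominated Recognition} described in the context correctly recognizes perfectly well-ve-dominated graphs (on input a graph $G$ it returns YES if $G$ is perfectly well-ve-dominated and NO otherwise) in time $O(n+m)$, where $n=|V(G)|$ and $m=|E(G)|$.
   Context: All graphs are finite, simple and undirected. A vertex $v$ ve-dominates an edge $e$ if at least one endpoint of $e$ belongs to the closed neighborhood $N_G[v]$. A set $D\subseteq V(G)$ is a ve-dominating set if every edge of $G$ is ve-dominated by some vertex of $D$; it is minimal if no proper subset is ve-dominating. $G$ is well-ve-dominated if all its minimal ve-dominating sets have the same cardinality, and perfectly well-ve-dominated if every induced subgraph of $G$ is well-ve-dominated. A cograph is a graph with no induced path $P_4$ on four vertices. A cotree of a cograph $G$ is a rooted tree whose leaves are the vertices of $G$ and whose internal nodes are labeled by disjoint union (union nodes) or join (join nodes); for a node $u$, $G_u$ is the subgraph of $G$ induced by the leaves in the subtree rooted at $u$, and for an internal node $u$, $G_u$ is the disjoint union or the join, according to the label of $u$, of the graphs $G_v$ over the children $v$ of $u$ (the join is the disjoint union together with all edges between distinct parts); the root $r$ satisfies $G_r=G$. A reduced cotree is one in which every internal node has at least two children and adjacent internal nodes have different labels. It is a known result (Corneil, Perl, Stewart) that one can decide in $O(n+m)$ time whether $G$ is a cograph and, if so, construct a reduced cotree of $G$. Algorithm \textsc{Perfectly Well-VE-Dominated Recognition}. Input: a graph $G$. Attempt to construct a reduced cotree $T_G$ of $G$ (by the known $O(n+m)$ procedure); if no such cotree exists, return NO. Otherwise process the nodes $u$ of $T_G$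 in postorder, computing Boolean values $e(u),a(u),b(u)$; write $C(u)$ for the set of children of $u$. (i) If $u$ is a leaf, set $e(u)=a(u)=b(u)=\text{False}$. (ii) If $u$ is a union node, set $e(u)=\bigvee_{v\in C(u)}e(v)$, $a(u)=\bigl(\bigvee_{v\in C(u)}a(v)\bigr)\vee e(u)$, and $b(u)=\bigl(\bigvee_{v\in C(u)}b(v)\bigr)\vee\bigl(|\{v\in C(u):e(v)\}|\ge 2\bigr)$. (iii) If $u$ is a join node: if $\bigvee_{v\in C(u)}b(v)$ holds or $|\{v\in C(u):a(v)\}|\ge 2$, return NO; otherwise set $e(u)=\text{True}$, $a(u)=\bigvee_{v\in C(u)}a(v)$, $b(u)=\bigvee_{v\in C(u)}b(v)$. After all nodes have been processed, return YES. *)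

theory Defs
  imports Main "HOL-Library.Monad_Syntax"
begin

section \<open>Graphs\<close>

record 'a graph =
  verts :: "'a set"
  edges :: "'a set set"

text \<open>The null graph is excluded: it has no cotree, so the algorithm is meaningless on it.\<close>

definition simple_graph :: "'a graph \<Rightarrow> bool" where
  "simple_graph G \<longleftrightarrow> finite (verts G) \<and> verts G \<noteq> {} \<and>
     (\<forall>e \<in> edges G. e \<subseteq> verts G \<and> card e = 2)"

definition induced :: "'a graph \<Rightarrow> 'a set \<Rightarrow> 'a graph" where
  "induced G S = \<lparr>verts = S, edges = {e \<in> edges G. e \<subseteq> S}\<rparr>"

definition closed_nbhd :: "'a graph \<Rightarrow> 'a \<Rightarrow> 'a set" where
  "closed_nbhd G v = insert v {u \<in> verts G. {v, u} \<in> edges G}"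

definition ve_dominates :: "'a graph \<Rightarrow> 'a \<Rightarrow> 'a set \<Rightarrow> bool" where
  "ve_dominates G v e \<longleftrightarrow> (\<exists>x \<in> e. x \<in> closed_nbhd G v)"

definition ve_dominating :: "'a graph \<Rightarrow> 'a set \<Rightarrow> bool" where
  "ve_dominating G D \<longleftrightarrow> D \<subseteq> verts G \<and> (\<forall>e \<in> edges G. \<exists>v \<in> D. ve_dominates G v e)"

definition minimal_ve_dominating :: "'a graph \<Rightarrow> 'a set \<Rightarrow> bool" where
  "minimal_ve_dominating G D \<longleftrightarrow> ve_dominating G D \<and> (\<forall>D'. D' \<subset> D \<longrightarrow> \<not> ve_dominating G D')"

definition well_ve_dominated :: "'a graph \<Rightarrow> bool" where
  "well_ve_dominated G \<longleftrightarrow>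
     (\<forall>D D'. minimal_ve_dominating G D \<longrightarrow> minimal_ve_dominating G D' \<longrightarrow> card D = card D')"

definition perfectly_well_ve_dominated :: "'a graph \<Rightarrow> bool" where
  "perfectly_well_ve_dominated G \<longleftrightarrow> (\<forall>S \<subseteq> verts G. well_ve_dominated (induced G S))"

definition cograph :: "'a graph \<Rightarrow> bool" where
  "cograph G \<longleftrightarrow> \<not> (\<exists>a b c d. distinct [a, b, c, d] \<and> {a, b, c, d} \<subseteq> verts G \<and>
     edges (induced G {a, b, c, d}) = {{a, b}, {b, c}, {c, d}})"

section \<open>Cotrees\<close>

text \<open>Lists of graphs stand for families of graphs with pairwise disjoint vertex sets.\<close>

definition graph_union :: "'a graph list \<Rightarrow> 'a graph" where
  "graph_union Gs = \<lparr>verts = (\<Union>H \<in> set Gs. verts H), edges = (\<Union>H \<in> set Gs. edges H)\<rparr>"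

definition graph_join :: "'a graph list \<Rightarrow> 'a graph" where
  "graph_join Gs = \<lparr>verts = verts (graph_union Gs),
     edges = edges (graph_union Gs) \<union>
       {{x, y} | x y i j. i < length Gs \<and> j < length Gs \<and> i \<noteq> j \<and>
                          x \<in> verts (Gs ! i) \<and> y \<in> verts (Gs ! j)}\<rparr>"

datatype 'a cotree =
    Leaf 'a
  | is_UnionNode: UnionNode "'a cotree list"
  | is_JoinNode: JoinNode "'a cotree list"

fun leaves :: "'a cotree \<Rightarrow> 'a list" where
  "leaves (Leaf v) = [v]"
| "leaves (UnionNode cs) = concat (map leaves cs)"
| "leaves (JoinNode cs) = concat (map leaves cs)"

text \<open>A node is identified with the subtree rooted at it.\<close>

fun nodes :: "'a cotree \<Rightarrow> 'a cotree set" where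
  "nodes (Leaf v) = {Leaf v}"
| "nodes (UnionNode cs) = insert (UnionNode cs) (\<Union>c \<in> set cs. nodes c)"
| "nodes (JoinNode cs) = insert (JoinNode cs) (\<Union>c \<in> set cs. nodes c)"

definition node_graph :: "'a graph \<Rightarrow> 'a cotree \<Rightarrow> 'a graph" where
  "node_graph G u = induced G (set (leaves u))"

definition cotree_of :: "'a graph \<Rightarrow> 'a cotree \<Rightarrow> bool" where
  "cotree_of G T \<longleftrightarrow> distinct (leaves T) \<and> set (leaves T) = verts G \<and>
     (\<forall>u \<in> nodes T. case u of
        Leaf v \<Rightarrow> True
      | UnionNode cs \<Rightarrow> cs \<noteq> [] \<and> node_graph G u = graph_union (map (node_graph G) cs)
      | JoinNode cs \<Rightarrow> cs \<noteq> [] \<and> node_graph G u = graph_join (map (node_graph G) cs))"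

definition reduced :: "'a cotree \<Rightarrow> bool" where
  "reduced T \<longleftrightarrow>
     (\<forall>u \<in> nodes T. case u of
        Leaf v \<Rightarrow> True
      | UnionNode cs \<Rightarrow> 2 \<le> length cs \<and> (\<forall>c \<in> set cs. \<not> is_UnionNode c)
      | JoinNode cs \<Rightarrow> 2 \<le> length cs \<and> (\<forall>c \<in> set cs. \<not> is_JoinNode c))"

section \<open>Timed computations\<close>

text \<open>
  A timed computation carries its result and the number of elementary steps it takes. Programs
  are composed only of \<open>tick\<close>, which charges one step for a bounded number of elementary
  operations (Boolean connectives, comparing or incrementing a counter, field selection,
  constructor application), of sequencing, and of case distinctions; every recursive call ends in
  a \<open>tick\<close>. Counters cost one step per operation, as in the unit-cost RAM model.
\<close>

datatype 'a tm = TM (val: 'a) (cost: nat)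

definition tick :: "'a \<Rightarrow> 'a tm" where
  "tick x = TM x 1"

definition bind_tm :: "'a tm \<Rightarrow> ('a \<Rightarrow> 'b tm) \<Rightarrow> 'b tm" where
  "bind_tm s f = TM (val (f (val s))) (cost s + cost (f (val s)))"

adhoc_overloading Monad_Syntax.bind \<rightleftharpoons> bind_tm

definition linear_time :: "('a graph \<Rightarrow> 'b tm) \<Rightarrow> bool" where
  "linear_time f \<longleftrightarrow>
     (\<exists>K. \<forall>G. simple_graph G \<longrightarrow> cost (f G) \<le> K * (card (verts G) + card (edges G)))"

text \<open>
  The specification met by the recognition procedure of Corneil, Perl and Stewart; it is
  combined with \<open>linear_time\<close> to describe that procedure as a black box.
\<close>

definition constructs_cotrees :: "('a graph \<Rightarrow> 'a cotree option tm) \<Rightarrow> bool" where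
  "constructs_cotrees construct \<longleftrightarrow>
     (\<forall>G. simple_graph G \<longrightarrow>
        (if cograph G
         then \<exists>T. val (construct G) = Some T \<and> cotree_of G T \<and> reduced T
         else val (construct G) = None))"

section \<open>The recognition algorithm\<close>

datatype flags = Flags (e_flag: bool) (a_flag: bool) (b_flag: bool)

datatype answer = YES | NO

fun any_flag :: "(flags \<Rightarrow> bool) \<Rightarrow> flags list \<Rightarrow> bool tm" where
  "any_flag p [] = tick False"
| "any_flag p (x # xs) = do { r \<leftarrow> any_flag p xs; tick (p x \<or> r) }"

fun count_flag :: "(flags \<Rightarrow> bool) \<Rightarrow> flags list \<Rightarrow> nat tm" where
  "count_flag p [] = tick 0"
| "count_flag p (x # xs) = do { k \<leftarrow> count_flag p xs; tick (if p x then Suc k else k) }"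

definition union_step :: "flags list \<Rightarrow> flags tm" where
  "union_step fs = do {
     e \<leftarrow> any_flag e_flag fs;
     a \<leftarrow> any_flag a_flag fs;
     b \<leftarrow> any_flag b_flag fs;
     k \<leftarrow> count_flag e_flag fs;
     tick (Flags e (a \<or> e) (b \<or> 2 \<le> k))
   }"

text \<open>Here and in \<open>process\<close>, \<open>None\<close> means that the algorithm has stopped with answer NO.\<close>

definition join_step :: "flags list \<Rightarrow> flags option tm" where
  "join_step fs = do {
     b \<leftarrow> any_flag b_flag fs;
     k \<leftarrow> count_flag a_flag fs;
     if b \<or> 2 \<le> k then tick None
     else do {
       a \<leftarrow> any_flag a_flag fs;
       b' \<leftarrow> any_flag b_flag fs;
       tick (Some (Flags True a b'))
     }
   }"

text \<open>\<open>process\<close> visits the nodes in postorder and returns the flags of the root.\<close>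

fun process :: "'a cotree \<Rightarrow> flags option tm"
  and process_children :: "'a cotree list \<Rightarrow> flags list option tm" where
  "process (Leaf v) = tick (Some (Flags False False False))"
| "process (UnionNode cs) = do {
     r \<leftarrow> process_children cs;
     case r of
       None \<Rightarrow> tick None
     | Some fs \<Rightarrow> do { f \<leftarrow> union_step fs; tick (Some f) }
   }"
| "process (JoinNode cs) = do {
     r \<leftarrow> process_children cs;
     case r of
       None \<Rightarrow> tick None
     | Some fs \<Rightarrow> do { f \<leftarrow> join_step fs; tick f }
   }"
| "process_children [] = tick (Some [])"
| "process_children (c # cs) = do {
     r \<leftarrow> process c;
     case r of
       None \<Rightarrow> tick None
     | Some f \<Rightarrow> do {
         r' \<leftarrow> process_children cs;
         case r' of
           None \<Rightarrow> tick None
         | Some fs \<Rightarrow> tick (Some (f # fs))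
       }
   }"

definition recognition :: "('a graph \<Rightarrow> 'a cotree option tm) \<Rightarrow> 'a graph \<Rightarrow> answer tm" where
  "recognition construct G = do {
     t \<leftarrow> construct G;
     case t of
       None \<Rightarrow> tick NO
     | Some T \<Rightarrow> do {
         r \<leftarrow> process T;
         case r of
           None \<Rightarrow> tick NO
         | Some f \<Rightarrow> tick YES
       }
   }"

end

theory Submission
  imports Defs
begin

text \<open>
  The graphs recognised are those without an induced path on four vertices, without an induced
  butterfly (two disjoint edges with no edge between them, and a vertex adjacent to all four ends),
  and without an induced join of two copies of \<open>K\<^sub>2 + K\<^sub>1\<close>. Each of these three graphs has a
  minimal ve-dominating set of one vertex and another of two vertices, so none of them may occur
  (\<open>forbidden_not_perfectly\<close>).

  Conversely, suppose that none of them occurs, and let two vertices of a minimal ve-dominating set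
  lie in the same component. Each of the two ve-dominates an edge that the other misses, and the
  two vertices, the two edges and a vertex linking them contain one of the forbidden graphs
  (\<open>no_mutually_private_edges\<close>). Hence a minimal ve-dominating set has at most one vertex in
  each component, and since a private edge of a vertex of one such set must be ve-dominated by a
  vertex of any other in the same component, any two of them have equally many vertices
  (\<open>forbidden_free_well_ve_dominated\<close>).

  The flags \<open>e\<close>, \<open>a\<close>, \<open>b\<close> of a cotree node say whether its graph contains an edge, an induced
  \<open>K\<^sub>2 + K\<^sub>1\<close>, an induced \<open>2K\<^sub>2\<close>. The last two have connected complements, so in a join
  they live inside a single part; the butterfly and the join of two \<open>K\<^sub>2 + K\<^sub>1\<close> are connected, so
  in a disjoint union they live inside a single part. In a join they arise anew exactly when some
  part has a \<open>2K\<^sub>2\<close> or two parts have a \<open>K\<^sub>2 + K\<^sub>1\<close>, which is the test for answering NO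
  (\<open>process_correct\<close>).

  The work at a node is linear in the number of its children, and a cotree whose internal nodes
  have at least two children has fewer internal nodes than leaves; \<open>process_cost\<close> turns
  this into a bound linear in the number of vertices.
\<close>

section \<open>Small induced subgraphs\<close>

definition adj :: "'a graph \<Rightarrow> 'a \<Rightarrow> 'a \<Rightarrow> bool" where
  "adj G x y \<longleftrightarrow> {x, y} \<in> edges G"

text \<open>
  In the patterns below the named vertices are automatically distinct when \<open>E\<close> is symmetric and
  irreflexive: any two of them are adjacent, or a third one is adjacent to exactly one of them.
\<close>

definition P4 :: "('a \<Rightarrow> 'a \<Rightarrow> bool) \<Rightarrow> 'a \<Rightarrow> 'a \<Rightarrow> 'a \<Rightarrow> 'a \<Rightarrow> bool" where
  "P4 E a b c d \<longleftrightarrow> E a b \<and> E b c \<and> E c d \<and> \<not> E a c \<and> \<not> E b d \<and> \<not> E a d"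

definition co_P3 :: "('a \<Rightarrow> 'a \<Rightarrow> bool) \<Rightarrow> 'a \<Rightarrow> 'a \<Rightarrow> 'a \<Rightarrow> bool" where
  "co_P3 E x y z \<longleftrightarrow> E x y \<and> \<not> E x z \<and> \<not> E y z"

definition two_K2 :: "('a \<Rightarrow> 'a \<Rightarrow> bool) \<Rightarrow> 'a \<Rightarrow> 'a \<Rightarrow> 'a \<Rightarrow> 'a \<Rightarrow> bool" where
  "two_K2 E a b c d \<longleftrightarrow> E a b \<and> E c d \<and> \<not> E a c \<and> \<not> E a d \<and> \<not> E b c \<and> \<not> E b d"

definition has_P4 :: "('a \<Rightarrow> 'a \<Rightarrow> bool) \<Rightarrow> 'a set \<Rightarrow> bool" where
  "has_P4 E S \<longleftrightarrow> (\<exists>a\<in>S. \<exists>b\<in>S. \<exists>c\<in>S. \<exists>d\<in>S. P4 E a b c d)"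

definition has_edge :: "('a \<Rightarrow> 'a \<Rightarrow> bool) \<Rightarrow> 'a set \<Rightarrow> bool" where
  "has_edge E S \<longleftrightarrow> (\<exists>x\<in>S. \<exists>y\<in>S. E x y)"

definition has_co_P3 :: "('a \<Rightarrow> 'a \<Rightarrow> bool) \<Rightarrow> 'a set \<Rightarrow> bool" where
  "has_co_P3 E S \<longleftrightarrow> (\<exists>x\<in>S. \<exists>y\<in>S. \<exists>z\<in>S. co_P3 E x y z)"

definition has_two_K2 :: "('a \<Rightarrow> 'a \<Rightarrow> bool) \<Rightarrow> 'a set \<Rightarrow> bool" where
  "has_two_K2 E S \<longleftrightarrow> (\<exists>a\<in>S. \<exists>b\<in>S. \<exists>c\<in>S. \<exists>d\<in>S. two_K2 E a b c d)"

definition has_butterfly :: "('a \<Rightarrow> 'a \<Rightarrow> bool) \<Rightarrow> 'a set \<Rightarrow> bool" where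
  "has_butterfly E S \<longleftrightarrow> (\<exists>a\<in>S. \<exists>b\<in>S. \<exists>c\<in>S. \<exists>d\<in>S. \<exists>z\<in>S.
     two_K2 E a b c d \<and> E a z \<and> E b z \<and> E c z \<and> E d z)"

definition has_double_co_P3 :: "('a \<Rightarrow> 'a \<Rightarrow> bool) \<Rightarrow> 'a set \<Rightarrow> bool" where
  "has_double_co_P3 E S \<longleftrightarrow> (\<exists>x\<in>S. \<exists>y\<in>S. \<exists>z\<in>S. \<exists>x'\<in>S. \<exists>y'\<in>S. \<exists>z'\<in>S.
     co_P3 E x y z \<and> co_P3 E x' y' z' \<and>
     E x x' \<and> E x y' \<and> E x z' \<and> E y x' \<and> E y y' \<and> E y z' \<and> E z x' \<and> E z y' \<and> E z z')"

definition forbidden :: "('a \<Rightarrow> 'a \<Rightarrow> bool) \<Rightarrow> 'a set \<Rightarrow> bool" where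
  "forbidden E S \<longleftrightarrow> has_butterfly E S \<or> has_double_co_P3 E S"

lemma has_P4_mono: "has_P4 E S \<Longrightarrow> S \<subseteq> T \<Longrightarrow> has_P4 E T"
  unfolding has_P4_def by (meson subsetD)

lemma forbidden_mono:
  assumes "forbidden E S" "S \<subseteq> T"
  shows "forbidden E T"
proof -
  have "has_butterfly E T" if "has_butterfly E S"
    using that assms(2) unfolding has_butterfly_def by (meson subsetD)
  moreover have "has_double_co_P3 E T" if "has_double_co_P3 E S"
  proof -
    from that obtain x y z x' y' z' where "x \<in> S" "y \<in> S" "z \<in> S" "x' \<in> S" "y' \<in> S" "z' \<in> S"
      and *: "co_P3 E x y z \<and> co_P3 E x' y' z' \<and>
     E x x' \<and> E x y' \<and> E x z' \<and> E y x' \<and> E y y' \<and> E y z' \<and> E z x' \<and> E z y' \<and> E z z'"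
      unfolding has_double_co_P3_def by blast
    then have "x \<in> T" "y \<in> T" "z \<in> T" "x' \<in> T" "y' \<in> T" "z' \<in> T" using assms(2) by auto
    then show ?thesis using * unfolding has_double_co_P3_def by blast
  qed
  ultimately show ?thesis using assms(1) unfolding forbidden_def by blast
qed

lemma pattern_cong:
  assumes "\<And>x y. x \<in> S \<Longrightarrow> y \<in> S \<Longrightarrow> E x y = F x y"
  shows "has_P4 E S = has_P4 F S" "forbidden E S = forbidden F S"
  unfolding has_P4_def forbidden_def has_butterfly_def has_double_co_P3_def
    P4_def co_P3_def two_K2_def
  by (simp_all add: assms cong: bex_cong)

section \<open>Simple graphs through adjacency\<close>

lemma adj_sym: "adj G x y \<Longrightarrow> adj G y x"
  by (simp add: adj_def insert_commute)

lemma adj_commute: "adj G x y \<longleftrightarrow> adj G y x"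
  by (simp add: adj_def insert_commute)

lemma adj_irrefl: "simple_graph G \<Longrightarrow> \<not> adj G x x"
  unfolding simple_graph_def adj_def by fastforce

lemma adj_verts: "simple_graph G \<Longrightarrow> adj G x y \<Longrightarrow> x \<in> verts G \<and> y \<in> verts G"
  unfolding simple_graph_def adj_def by blast

lemma edge_cases:
  assumes "simple_graph G" "e \<in> edges G"
  obtains x y where "e = {x, y}" "adj G x y"
  using assms unfolding simple_graph_def adj_def by (metis card_2_iff)

lemma adj_induced: "adj (induced G S) x y \<longleftrightarrow> adj G x y \<and> x \<in> S \<and> y \<in> S"
  by (auto simp: adj_def induced_def)

lemma verts_induced [simp]: "verts (induced G S) = S"
  by (simp add: induced_def)

lemma simple_graph_induced:
  "simple_graph G \<Longrightarrow> S \<subseteq> verts G \<Longrightarrow> S \<noteq> {} \<Longrightarrow> simple_graph (induced G S)"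
  unfolding simple_graph_def induced_def using finite_subset by auto

lemma cograph_iff_no_P4:
  assumes G: "simple_graph G"
  shows "cograph G \<longleftrightarrow> \<not> has_P4 (adj G) (verts G)"
proof -
  have "(distinct [a, b, c, d] \<and> {a, b, c, d} \<subseteq> verts G \<and>
      edges (induced G {a, b, c, d}) = {{a, b}, {b, c}, {c, d}}) \<longleftrightarrow>
      (P4 (adj G) a b c d \<and> {a, b, c, d} \<subseteq> verts G)" (is "?L \<longleftrightarrow> ?R") for a b c d
  proof
    assume ?L
    then have d: "distinct [a, b, c, d]" and
      E: "edges (induced G {a, b, c, d}) = {{a, b}, {b, c}, {c, d}}" by auto
    have "adj G x y \<longleftrightarrow> {x, y} \<in> {{a, b}, {b, c}, {c, d}}"
      if "x \<in> {a, b, c, d}" "y \<in> {a, b, c, d}" for x y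
      using that unfolding E[symmetric] by (auto simp: adj_def induced_def)
    with d have "P4 (adj G) a b c d" unfolding P4_def by (auto simp: doubleton_eq_iff)
    with \<open>?L\<close> show ?R by blast
  next
    assume R: ?R
    then have e: "adj G a b" "adj G b c" "adj G c d"
      and n: "\<not> adj G a c" "\<not> adj G b d" "\<not> adj G a d" by (auto simp: P4_def)
    note sy = adj_commute[of G] and ir = adj_irrefl[OF G]
    have d: "distinct [a, b, c, d]"
      using e n ir sy by (metis distinct_length_2_or_more distinct_singleton)
    have pairs: "\<forall>x\<in>{a, b, c, d}. \<forall>y\<in>{a, b, c, d}. adj G x y \<longrightarrow>
        {x, y} \<in> {{a, b}, {b, c}, {c, d}}"
      using n ir sy by (simp add: insert_commute)
    have "edges (induced G {a, b, c, d}) \<subseteq> {{a, b}, {b, c}, {c, d}}"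
    proof
      fix e assume "e \<in> edges (induced G {a, b, c, d})"
      then have e: "e \<in> edges G" "e \<subseteq> {a, b, c, d}" by (auto simp: induced_def)
      then obtain x y where xy: "e = {x, y}" "adj G x y" using edge_cases[OF G] by metis
      then have "x \<in> {a, b, c, d}" "y \<in> {a, b, c, d}" using e by blast+
      then show "e \<in> {{a, b}, {b, c}, {c, d}}" using pairs xy by blast
    qed
    moreover have "{{a, b}, {b, c}, {c, d}} \<subseteq> edges (induced G {a, b, c, d})"
      using e by (auto simp: adj_def induced_def)
    ultimately show ?L using d R by blast
  qed
  then show ?thesis unfolding cograph_def has_P4_def by simp blast
qed

definition covers :: "('a \<Rightarrow> 'a \<Rightarrow> bool) \<Rightarrow> 'a \<Rightarrow> 'a \<Rightarrow> 'a \<Rightarrow> bool" where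
  "covers E v x y \<longleftrightarrow> v = x \<or> v = y \<or> E v x \<or> E v y"

lemma ve_dominates_iff:
  assumes "simple_graph G" "adj G x y"
  shows "ve_dominates G v {x, y} \<longleftrightarrow> covers (adj G) v x y"
  using adj_verts[OF assms]
  unfolding ve_dominates_def closed_nbhd_def covers_def adj_def by auto

lemma ve_dominating_iff:
  assumes "simple_graph G"
  shows "ve_dominating G D \<longleftrightarrow>
    D \<subseteq> verts G \<and> (\<forall>x y. adj G x y \<longrightarrow> (\<exists>v\<in>D. covers (adj G) v x y))"
  unfolding ve_dominating_def
  using ve_dominates_iff[OF assms] edge_cases[OF assms] by (metis adj_def)

section \<open>Forbidden graphs are not well-ve-dominated\<close>

lemma ve_dominating_induced_iff:
  assumes G: "simple_graph G" and S: "S \<subseteq> verts G" "S \<noteq> {}"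
  shows "ve_dominating (induced G S) D \<longleftrightarrow>
    D \<subseteq> S \<and> (\<forall>x\<in>S. \<forall>y\<in>S. adj G x y \<longrightarrow> (\<exists>v\<in>D. covers (adj G) v x y))"
proof -
  have "covers (adj (induced G S)) v x y = covers (adj G) v x y"
    if "v \<in> S" "x \<in> S" "y \<in> S" for v x y
    using that by (simp add: covers_def adj_induced)
  then show ?thesis
    unfolding ve_dominating_iff[OF simple_graph_induced[OF assms]] verts_induced adj_induced
    by (meson subsetD)
qed

lemma induced_not_well_ve_dominated:
  assumes G: "simple_graph G" and S: "S \<subseteq> verts G" "{v, x, y, a, b, c, d} \<subseteq> S"
    and v: "\<forall>p\<in>S. \<forall>q\<in>S. adj G p q \<longrightarrow> covers (adj G) v p q"
    and xy: "\<forall>p\<in>S. \<forall>q\<in>S. adj G p q \<longrightarrow> covers (adj G) x p q \<or> covers (adj G) y p q"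
    and a: "adj G a b" "\<not> covers (adj G) x a b" and c: "adj G c d" "\<not> covers (adj G) y c d"
  shows "\<not> well_ve_dominated (induced G S)"
proof -
  let ?H = "induced G S"
  have "S \<noteq> {}" using S by blast
  note dom = ve_dominating_induced_iff[OF G S(1) this]
  have e: "\<not> ve_dominating ?H {}" "\<not> ve_dominating ?H {x}" "\<not> ve_dominating ?H {y}"
    using a c S(2) unfolding dom by auto
  have dv: "ve_dominating ?H {v}" and dxy: "ve_dominating ?H {x, y}"
    using v xy S(2) unfolding dom by auto
  have "x \<noteq> y" using e dxy by auto
  moreover have "minimal_ve_dominating ?H {v}"
  proof -
    have "D = {}" if "D \<subset> {v}" for D using that by auto
    then show ?thesis unfolding minimal_ve_dominating_def using dv e by metis
  qed
  moreover have "minimal_ve_dominating ?H {x, y}"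
  proof -
    have "D = {} \<or> D = {x} \<or> D = {y}" if "D \<subset> {x, y}" for D using that by auto
    then show ?thesis unfolding minimal_ve_dominating_def using dxy e by metis
  qed
  moreover have "card {v} \<noteq> card {x, y}" using \<open>x \<noteq> y\<close> by simp
  ultimately show ?thesis unfolding well_ve_dominated_def by blast
qed

text \<open>
  The dominating single vertex is an inner vertex of the path, the centre of the butterfly, or an
  end of the edge of one \<open>K\<^sub>2 + K\<^sub>1\<close>; the dominating pair consists of the two ends of the path, one
  vertex from each edge of the \<open>2K\<^sub>2\<close>, or the isolated vertices of the two \<open>K\<^sub>2 + K\<^sub>1\<close>.
\<close>

lemma forbidden_not_perfectly:
  assumes G: "simple_graph G"
    and P: "has_P4 (adj G) (verts G) \<or> forbidden (adj G) (verts G)"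
  shows "\<not> perfectly_well_ve_dominated G"
proof -
  note sy = adj_commute[of G] and ir = adj_irrefl[OF G]
  have "\<exists>S\<subseteq>verts G. \<not> well_ve_dominated (induced G S)"
    using P unfolding forbidden_def
  proof (elim disjE)
    assume "has_P4 (adj G) (verts G)"
    then obtain a b c d where S: "{a, b, c, d} \<subseteq> verts G" and p: "P4 (adj G) a b c d"
      unfolding has_P4_def by blast
    then have "a \<noteq> c" "a \<noteq> d" "b \<noteq> d" using sy unfolding P4_def by blast+
    then have "\<not> well_ve_dominated (induced G {a, b, c, d})"
      using p ir by (intro induced_not_well_ve_dominated[OF G S, of b a d c d a b])
        (simp_all add: covers_def P4_def sy)
    then show ?thesis using S by blast
  next
    assume "has_butterfly (adj G) (verts G)"
    then obtain a b c d z where S: "{a, b, c, d, z} \<subseteq> verts G" and p: "two_K2 (adj G) a b c d"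
      and z: "adj G a z" "adj G b z" "adj G c z" "adj G d z"
      unfolding has_butterfly_def by blast
    have "a \<noteq> c" "a \<noteq> d" "b \<noteq> c" "b \<noteq> d" using p sy unfolding two_K2_def by blast+
    then have "\<not> well_ve_dominated (induced G {a, b, c, d, z})"
      using p z ir by (intro induced_not_well_ve_dominated[OF G S, of z a c c d a b])
        (simp_all add: covers_def two_K2_def sy)
    then show ?thesis using S by blast
  next
    assume "has_double_co_P3 (adj G) (verts G)"
    then obtain x y z x' y' z' where S: "{x, y, z, x', y', z'} \<subseteq> verts G"
      and p: "co_P3 (adj G) x y z" "co_P3 (adj G) x' y' z'"
      and c: "adj G x x'" "adj G x y'" "adj G x z'" "adj G y x'" "adj G y y'" "adj G y z'"
      "adj G z x'" "adj G z y'" "adj G z z'"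
      unfolding has_double_co_P3_def by blast
    have "z \<noteq> x" "z \<noteq> y" "z' \<noteq> x'" "z' \<noteq> y'" using p sy unfolding co_P3_def by blast+
    then have "\<not> well_ve_dominated (induced G {x, y, z, x', y', z'})"
      using p c ir by (intro induced_not_well_ve_dominated[OF G S, of x z z' x y x' y'])
        (simp_all add: covers_def co_P3_def sy)
    then show ?thesis using S by blast
  qed
  then show ?thesis unfolding perfectly_well_ve_dominated_def by blast
qed

section \<open>Minimal ve-dominating sets of graphs without forbidden subgraphs\<close>

text \<open>Without an induced path on four vertices this is the relation of lying in one component.\<close>

definition near :: "('a \<Rightarrow> 'a \<Rightarrow> bool) \<Rightarrow> 'a set \<Rightarrow> 'a \<Rightarrow> 'a \<Rightarrow> bool" where
  "near E S v w \<longleftrightarrow> v = w \<or> E v w \<or> (\<exists>m\<in>S. E v m \<and> E m w)"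

locale P4_free =
  fixes E :: "'a \<Rightarrow> 'a \<Rightarrow> bool" and S :: "'a set"
  assumes sym: "E x y \<Longrightarrow> E y x"
    and field: "E x y \<Longrightarrow> x \<in> S"
    and no_P4: "\<not> has_P4 E S"
begin

lemma not_P4: "\<not> P4 E a b c d"
proof
  assume "P4 E a b c d"
  moreover from this have "a \<in> S" "b \<in> S" "c \<in> S" "d \<in> S"
    using field sym unfolding P4_def by blast+
  ultimately show False using no_P4 unfolding has_P4_def by blast
qed

lemma near_step: "near E S v w \<Longrightarrow> E w u \<Longrightarrow> near E S v u"
  using not_P4 field sym unfolding near_def P4_def by metis

lemma near_sym: "near E S v w \<Longrightarrow> near E S w v"
  unfolding near_def using sym by blast

lemma near_trans: "near E S u v \<Longrightarrow> near E S v w \<Longrightarrow> near E S u w"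
  using near_step unfolding near_def[of E S v w] by blast

lemma near_if_cover_same_edge:
  assumes "E x y" "covers E v x y" "covers E w x y"
  shows "near E S v w"
proof -
  have "near E S u x" if "covers E u x y" for u
    using that assms(1) near_step[of u u] near_step[of u y x] sym
    unfolding covers_def by (metis near_def)
  then show ?thesis using assms near_sym near_trans by blast
qed

text \<open>
  If \<open>v\<close> and \<open>w\<close> are not adjacent, each private edge can be moved so that it starts at its
  dominating vertex; the two edges then form a \<open>2K\<^sub>2\<close>, and a common neighbour of \<open>v\<close> and \<open>w\<close>
  completes a butterfly. If \<open>v\<close> and \<open>w\<close> are adjacent, the absence of induced paths forces
  \<open>v\<close> to be adjacent to both ends of its private edge \<open>xx'\<close>, likewise \<open>w\<close> to those of \<open>yy'\<close>,
  and all edges between the two edges to be present. Then \<open>x, x', w\<close> and \<open>y, y', v\<close> are two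
  joined copies of \<open>K\<^sub>2 + K\<^sub>1\<close>.
\<close>

lemma no_mutually_private_edges:
  assumes free: "\<not> forbidden E S"
    and e: "E x x'" "covers E v x x'" "\<not> covers E w x x'"
    and f: "E y y'" "covers E w y y'" "\<not> covers E v y y'"
    and near: "near E S v w"
  shows False
proof (cases "E v w")
  case False
  have "\<exists>x0. E v x0 \<and> \<not> E w x0 \<and> w \<noteq> x0"
    using e sym unfolding covers_def by blast
  then obtain x0 where x0: "E v x0" "\<not> E w x0" "w \<noteq> x0" by blast
  have "\<exists>y0. E w y0 \<and> \<not> E v y0 \<and> v \<noteq> y0"
    using f sym unfolding covers_def by blast
  then obtain y0 where y0: "E w y0" "\<not> E v y0" "v \<noteq> y0" by blast
  have "v \<noteq> w" using e by blast
  then obtain m where m: "E v m" "E m w" using near False unfolding near_def by blast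
  have "\<not> E x0 y0" using not_P4[of v x0 y0 w] x0 y0 False sym unfolding P4_def by blast
  then have "two_K2 E v x0 w y0" using x0 y0 False sym unfolding two_K2_def by blast
  moreover have "E x0 m" using not_P4[of x0 v m w] x0 m False sym unfolding P4_def by blast
  moreover have "E y0 m" using not_P4[of v m w y0] y0 m False sym unfolding P4_def by blast
  moreover have "{v, x0, w, y0, m} \<subseteq> S" using x0 y0 m field sym by blast
  ultimately have "has_butterfly E S" unfolding has_butterfly_def using m sym by blast
  then show False using free by (simp add: forbidden_def)
next
  case True
  have private_ends: "E p a \<and> E p a'"
    if "E p q" "E a a'" "covers E p a a'" "\<not> covers E q a a'" for p q a a'
  proof -
    have "p \<noteq> a" "p \<noteq> a'" "\<not> E a q" "\<not> E a' q"
      using that sym unfolding covers_def by blast+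
    then show ?thesis
      using that not_P4[of a' a p q] not_P4[of a a' p q] sym unfolding covers_def P4_def by blast
  qed
  have v: "E v x" "E v x'" using private_ends[OF True e] by auto
  have w: "E w y" "E w y'" using private_ends[OF sym[OF True] f] by auto
  have cross: "E p q" if "E v p" "E w q" "\<not> E w p" "\<not> E v q" for p q
    using that True not_P4[of p v w q] sym unfolding P4_def by blast
  have n: "\<not> E w x" "\<not> E w x'" "\<not> E v y" "\<not> E v y'"
    using e f unfolding covers_def by auto
  have "co_P3 E x x' w" "co_P3 E y y' v"
    using e f n sym unfolding co_P3_def by blast+
  moreover have "E x y" "E x y'" "E x' y" "E x' y'" using cross v w n by blast+
  moreover have "x \<in> S" "x' \<in> S" "y \<in> S" "y' \<in> S" "v \<in> S" "w \<in> S"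
    using field v w sym by blast+
  ultimately have "has_double_co_P3 E S"
    unfolding has_double_co_P3_def using v w True sym by blast
  then show False using free by (simp add: forbidden_def)
qed

end

lemma minimal_ve_dominating_private_edge:
  assumes G: "simple_graph G" and D: "minimal_ve_dominating G D" and v: "v \<in> D"
  obtains x y where "adj G x y" "covers (adj G) v x y"
    "\<And>w. w \<in> D \<Longrightarrow> w \<noteq> v \<Longrightarrow> \<not> covers (adj G) w x y"
proof -
  have "ve_dominating G D" "\<not> ve_dominating G (D - {v})"
    using D v unfolding minimal_ve_dominating_def by blast+
  then show thesis using that unfolding ve_dominating_iff[OF G] by blast
qed

text \<open>
  Sending a vertex of one minimal set to a vertex of another that ve-dominates one of its private
  edges stays within the component, so it is injective; by symmetry the two sets are equally large.
\<close>

lemma forbidden_free_well_ve_dominated: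
  assumes G: "simple_graph G"
    and "\<not> has_P4 (adj G) (verts G)" and free: "\<not> forbidden (adj G) (verts G)"
  shows "well_ve_dominated G"
proof -
  interpret P4_free "adj G" "verts G"
    using assms(2) adj_sym[of G] adj_verts[OF G] by unfold_locales simp_all
  let ?near = "near (adj G) (verts G)"
  have eq: "v = w" if D: "minimal_ve_dominating G D" and "v \<in> D" "w \<in> D" "?near v w" for D v w
  proof (rule ccontr)
    assume "v \<noteq> w"
    obtain x x' where x: "adj G x x'" "covers (adj G) v x x'" "\<not> covers (adj G) w x x'"
      using minimal_ve_dominating_private_edge[OF G D \<open>v \<in> D\<close>] \<open>w \<in> D\<close> \<open>v \<noteq> w\<close> by metis
    obtain y y' where y: "adj G y y'" "covers (adj G) w y y'" "\<not> covers (adj G) v y y'"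
      using minimal_ve_dominating_private_edge[OF G D \<open>w \<in> D\<close>] \<open>v \<in> D\<close> \<open>v \<noteq> w\<close> by metis
    show False using no_mutually_private_edges[OF free x y \<open>?near v w\<close>] .
  qed
  have le: "card D \<le> card D'"
    if D: "minimal_ve_dominating G D" and D': "minimal_ve_dominating G D'" for D D'
  proof -
    have dom: "ve_dominating G D'" using D' by (simp add: minimal_ve_dominating_def)
    have "\<exists>w\<in>D'. ?near v w" if v: "v \<in> D" for v
    proof -
      obtain x y where xy: "adj G x y" "covers (adj G) v x y"
        using minimal_ve_dominating_private_edge[OF G D v] by metis
      then obtain w where "w \<in> D'" "covers (adj G) w x y"
        using dom unfolding ve_dominating_iff[OF G] by blast
      then show ?thesis using near_if_cover_same_edge[OF xy] by blast
    qed
    then obtain f where f: "\<And>v. v \<in> D \<Longrightarrow> f v \<in> D' \<and> ?near v (f v)" by metis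
    have "inj_on f D"
    proof (rule inj_onI)
      fix u v assume uv: "u \<in> D" "v \<in> D" "f u = f v"
      then have "?near u (f u)" "?near (f u) v" using f[of u] f[of v] near_sym by simp_all
      then show "u = v" using eq[OF D] uv(1,2) near_trans by blast
    qed
    moreover have "finite D'"
      using dom G finite_subset unfolding ve_dominating_def simple_graph_def by blast
    ultimately show ?thesis using f by (meson card_inj_on_le image_subsetI)
  qed
  show ?thesis unfolding well_ve_dominated_def using le by (simp add: antisym)
qed

lemma well_ve_dominated_null: "verts G = {} \<Longrightarrow> well_ve_dominated G"
  unfolding well_ve_dominated_def minimal_ve_dominating_def ve_dominating_def by auto

theorem perfectly_well_ve_dominated_iff:
  assumes G: "simple_graph G"
  shows "perfectly_well_ve_dominated G \<longleftrightarrow> cograph G \<and> \<not> forbidden (adj G) (verts G)"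
proof
  show "perfectly_well_ve_dominated G \<Longrightarrow> cograph G \<and> \<not> forbidden (adj G) (verts G)"
    using forbidden_not_perfectly[OF G] cograph_iff_no_P4[OF G] by blast
next
  assume free: "cograph G \<and> \<not> forbidden (adj G) (verts G)"
  have "well_ve_dominated (induced G S)" if S: "S \<subseteq> verts G" for S
  proof (cases "S = {}")
    case True
    then show ?thesis by (simp add: well_ve_dominated_null)
  next
    case False
    have "adj (induced G S) x y = adj G x y" if "x \<in> S" "y \<in> S" for x y
      using that by (simp add: adj_induced)
    note cong = pattern_cong[of S "adj (induced G S)" "adj G", OF this]
    have "\<not> has_P4 (adj G) S" "\<not> forbidden (adj G) S"
      using free S has_P4_mono forbidden_mono cograph_iff_no_P4[OF G] by blast+
    then show ?thesis
      using forbidden_free_well_ve_dominated[OF simple_graph_induced[OF G S False]] cong by simp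
  qed
  then show "perfectly_well_ve_dominated G" unfolding perfectly_well_ve_dominated_def by blast
qed

section \<open>Patterns in disjoint unions and joins\<close>

locale parts =
  fixes E :: "'a \<Rightarrow> 'a \<Rightarrow> bool" and I :: "'i set" and A :: "'i \<Rightarrow> 'a set"
  assumes sym: "E x y \<Longrightarrow> E y x"
begin

abbreviation S :: "'a set" where "S \<equiv> \<Union>i\<in>I. A i"

lemma mono_parts:
  assumes "i \<in> I"
  shows "has_edge E (A i) \<Longrightarrow> has_edge E S" "has_co_P3 E (A i) \<Longrightarrow> has_co_P3 E S"
    "has_two_K2 E (A i) \<Longrightarrow> has_two_K2 E S" "forbidden E (A i) \<Longrightarrow> forbidden E S"
proof -
  have sub: "A i \<subseteq> S" using assms by blast
  show "has_edge E (A i) \<Longrightarrow> has_edge E S" "has_co_P3 E (A i) \<Longrightarrow> has_co_P3 E S"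
    "has_two_K2 E (A i) \<Longrightarrow> has_two_K2 E S"
    using subsetD[OF sub] unfolding has_edge_def has_co_P3_def has_two_K2_def by meson+
  show "forbidden E (A i) \<Longrightarrow> forbidden E S" using forbidden_mono sub by blast
qed

end

locale union_parts = parts +
  assumes apart: "i \<in> I \<Longrightarrow> j \<in> I \<Longrightarrow> i \<noteq> j \<Longrightarrow> x \<in> A i \<Longrightarrow> y \<in> A j \<Longrightarrow> \<not> E x y"
begin

lemma edge_in_part: "E x y \<Longrightarrow> y \<in> S \<Longrightarrow> i \<in> I \<Longrightarrow> x \<in> A i \<Longrightarrow> y \<in> A i"
  using apart by blast

lemma has_edge_union: "has_edge E S \<longleftrightarrow> (\<exists>i\<in>I. has_edge E (A i))"
proof
  assume "has_edge E S"
  then obtain i x y where i: "i \<in> I" "x \<in> A i" and y: "y \<in> S" "E x y"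
    unfolding has_edge_def by blast
  then have "y \<in> A i" using edge_in_part[OF y(2,1) i] by simp
  then show "\<exists>i\<in>I. has_edge E (A i)" using i y unfolding has_edge_def by blast
qed (use mono_parts(1) in blast)

lemma has_co_P3_union:
  assumes two: "\<And>i. i \<in> I \<Longrightarrow> \<exists>j\<in>I. j \<noteq> i \<and> A j \<noteq> {}"
  shows "has_co_P3 E S \<longleftrightarrow> (\<exists>i\<in>I. has_co_P3 E (A i)) \<or> has_edge E S"
proof
  assume "has_co_P3 E S"
  then show "(\<exists>i\<in>I. has_co_P3 E (A i)) \<or> has_edge E S"
    unfolding has_co_P3_def co_P3_def has_edge_def by blast
next
  assume "(\<exists>i\<in>I. has_co_P3 E (A i)) \<or> has_edge E S"
  then show "has_co_P3 E S"
  proof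
    show "\<exists>i\<in>I. has_co_P3 E (A i) \<Longrightarrow> has_co_P3 E S" using mono_parts(2) by blast
  next
    assume "has_edge E S"
    then obtain i where i: "i \<in> I" and "has_edge E (A i)" using has_edge_union by blast
    then obtain x y where xy: "x \<in> A i" "y \<in> A i" "E x y" unfolding has_edge_def by blast
    obtain j z where j: "j \<in> I" "j \<noteq> i" "z \<in> A j" using two[OF i] by blast
    then have "co_P3 E x y z" using apart i xy unfolding co_P3_def by blast
    then show "has_co_P3 E S" unfolding has_co_P3_def using i j xy by blast
  qed
qed

lemma has_two_K2_union:
  "has_two_K2 E S \<longleftrightarrow> (\<exists>i\<in>I. has_two_K2 E (A i)) \<or>
     (\<exists>i\<in>I. \<exists>j\<in>I. i \<noteq> j \<and> has_edge E (A i) \<and> has_edge E (A j))" (is "_ \<longleftrightarrow> ?R")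
proof
  assume "has_two_K2 E S"
  then obtain a b c d i j where p: "two_K2 E a b c d" and b: "b \<in> S" and d: "d \<in> S"
    and i: "i \<in> I" "a \<in> A i" and j: "j \<in> I" "c \<in> A j"
    unfolding has_two_K2_def by blast
  have "E a b" "E c d" using p unfolding two_K2_def by simp_all
  then have i': "b \<in> A i" and j': "d \<in> A j"
    using edge_in_part[OF _ b i] edge_in_part[OF _ d j] by simp_all
  show ?R
  proof (cases "i = j")
    case True
    then show ?thesis using i i' j j' p unfolding has_two_K2_def by blast
  next
    case False
    have "has_edge E (A i)" "has_edge E (A j)"
      using i i' j j' \<open>E a b\<close> \<open>E c d\<close> unfolding has_edge_def by blast+
    then show ?thesis using i(1) j(1) False by blast
  qed
next
  assume ?R
  then show "has_two_K2 E S"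
  proof
    show "\<exists>i\<in>I. has_two_K2 E (A i) \<Longrightarrow> has_two_K2 E S" using mono_parts(3) by blast
  next
    assume "\<exists>i\<in>I. \<exists>j\<in>I. i \<noteq> j \<and> has_edge E (A i) \<and> has_edge E (A j)"
    then obtain i j a b c d where i: "i \<in> I" "a \<in> A i" "b \<in> A i" "E a b"
      and j: "j \<in> I" "c \<in> A j" "d \<in> A j" "E c d" and ne: "i \<noteq> j"
      unfolding has_edge_def by blast
    then have "two_K2 E a b c d" using apart[OF i(1) j(1) ne] unfolding two_K2_def by blast
    then show "has_two_K2 E S" unfolding has_two_K2_def using i j by blast
  qed
qed

text \<open>
  Both forbidden graphs are connected: every vertex of the butterfly is adjacent to its centre, and
  in a join of two graphs a vertex of one side reaches the rest of its own side through the other.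
\<close>

lemma forbidden_union: "forbidden E S \<longleftrightarrow> (\<exists>i\<in>I. forbidden E (A i))"
proof
  assume "forbidden E S"
  then show "\<exists>i\<in>I. forbidden E (A i)"
    unfolding forbidden_def
  proof (elim disjE)
    assume "has_butterfly E S"
    then obtain a b c d z i where s: "a \<in> S" "b \<in> S" "c \<in> S" "d \<in> S"
      and i: "i \<in> I" "z \<in> A i" and p: "two_K2 E a b c d" "E a z" "E b z" "E c z" "E d z"
      unfolding has_butterfly_def by blast
    have "a \<in> A i" "b \<in> A i" "c \<in> A i" "d \<in> A i"
      using p(2-5) s by (simp_all add: edge_in_part[OF sym _ i])
    then have "has_butterfly E (A i)" unfolding has_butterfly_def using i p by blast
    then show "\<exists>i\<in>I. has_butterfly E (A i) \<or> has_double_co_P3 E (A i)" using i by blast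
  next
    assume "has_double_co_P3 E S"
    then obtain x y z x' y' z' i where s: "y \<in> S" "z \<in> S" "x' \<in> S" "y' \<in> S" "z' \<in> S"
      and i: "i \<in> I" "x \<in> A i" and p: "co_P3 E x y z" "co_P3 E x' y' z'"
      "E x x'" "E x y'" "E x z'" "E y x'" "E y y'" "E y z'" "E z x'" "E z y'" "E z z'"
      unfolding has_double_co_P3_def by blast
    have r: "x' \<in> A i" "y' \<in> A i" "z' \<in> A i"
      using edge_in_part[OF p(3) s(3) i] edge_in_part[OF p(4) s(4) i] edge_in_part[OF p(5) s(5) i]
      by simp_all
    have "y \<in> A i" "z \<in> A i"
      using edge_in_part[OF sym[OF p(6)] s(1) i(1) r(1)] edge_in_part[OF sym[OF p(9)] s(2) i(1) r(1)]
      by simp_all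
    then have "has_double_co_P3 E (A i)" unfolding has_double_co_P3_def using i r p by blast
    then show "\<exists>i\<in>I. has_butterfly E (A i) \<or> has_double_co_P3 E (A i)" using i by blast
  qed
qed (use mono_parts(4) in blast)

end

locale join_parts = parts +
  assumes together: "i \<in> I \<Longrightarrow> j \<in> I \<Longrightarrow> i \<noteq> j \<Longrightarrow> x \<in> A i \<Longrightarrow> y \<in> A j \<Longrightarrow> E x y"
    and two: "i \<in> I \<Longrightarrow> \<exists>j\<in>I. j \<noteq> i \<and> A j \<noteq> {}"
    and part_nonempty: "i \<in> I \<Longrightarrow> A i \<noteq> {}"
    and index_nonempty: "I \<noteq> {}"
begin

lemma nonedge_in_part: "\<not> E x y \<Longrightarrow> y \<in> S \<Longrightarrow> i \<in> I \<Longrightarrow> x \<in> A i \<Longrightarrow> y \<in> A i"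
  using together by blast

lemma has_edge_join: "has_edge E S"
proof -
  obtain i x where i: "i \<in> I" "x \<in> A i" using index_nonempty part_nonempty by blast
  obtain j y where "j \<in> I" "j \<noteq> i" "y \<in> A j" using two[OF i(1)] by blast
  then show ?thesis using i together unfolding has_edge_def by blast
qed

text \<open>
  The next two facts trace the complements of \<open>K\<^sub>2 + K\<^sub>1\<close> and \<open>2K\<^sub>2\<close>, a path and a cycle: by
  \<open>nonedge_in_part\<close> a non-edge never leaves its part.
\<close>

lemma co_P3_in_part:
  assumes "co_P3 E x y z" "x \<in> S" "y \<in> S" "z \<in> S"
  obtains i where "i \<in> I" "x \<in> A i" "y \<in> A i" "z \<in> A i"
proof -
  obtain i where i: "i \<in> I" "z \<in> A i" using assms by blast
  have "\<not> E z x" "\<not> E z y" using assms sym unfolding co_P3_def by blast+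
  then show thesis using that i assms nonedge_in_part by blast
qed

lemma two_K2_in_part:
  assumes "two_K2 E a b c d" "a \<in> S" "b \<in> S" "c \<in> S" "d \<in> S"
  obtains i where "i \<in> I" "a \<in> A i" "b \<in> A i" "c \<in> A i" "d \<in> A i"
proof -
  obtain i where i: "i \<in> I" "a \<in> A i" using assms by blast
  have n: "\<not> E a c" "\<not> E a d" "\<not> E c b" using assms sym unfolding two_K2_def by blast+
  then have "c \<in> A i" "d \<in> A i" using i assms nonedge_in_part by blast+
  then show thesis using that i n assms nonedge_in_part by blast
qed

lemma has_co_P3_join: "has_co_P3 E S \<longleftrightarrow> (\<exists>i\<in>I. has_co_P3 E (A i))"
proof
  assume "has_co_P3 E S"
  then obtain x y z where p: "co_P3 E x y z" "x \<in> S" "y \<in> S" "z \<in> S"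
    unfolding has_co_P3_def by blast
  show "\<exists>i\<in>I. has_co_P3 E (A i)"
    using co_P3_in_part[OF p] p(1) unfolding has_co_P3_def by metis
qed (use mono_parts(2) in blast)

lemma has_two_K2_join: "has_two_K2 E S \<longleftrightarrow> (\<exists>i\<in>I. has_two_K2 E (A i))"
proof
  assume "has_two_K2 E S"
  then obtain a b c d where p: "two_K2 E a b c d" "a \<in> S" "b \<in> S" "c \<in> S" "d \<in> S"
    unfolding has_two_K2_def by blast
  show "\<exists>i\<in>I. has_two_K2 E (A i)"
    using two_K2_in_part[OF p] p(1) unfolding has_two_K2_def by metis
qed (use mono_parts(3) in blast)

text \<open>
  A vertex of any other part is the centre of a butterfly over a \<open>2K\<^sub>2\<close>. Two \<open>K\<^sub>2 + K\<^sub>1\<close> in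
  different parts are joined by construction, while two in the same part make a forbidden graph of
  that part already.
\<close>

lemma forbidden_join:
  "forbidden E S \<longleftrightarrow> (\<exists>i\<in>I. forbidden E (A i)) \<or> (\<exists>i\<in>I. has_two_K2 E (A i)) \<or>
     (\<exists>i\<in>I. \<exists>j\<in>I. i \<noteq> j \<and> has_co_P3 E (A i) \<and> has_co_P3 E (A j))" (is "_ \<longleftrightarrow> ?R")
proof
  assume "forbidden E S"
  then show ?R
    unfolding forbidden_def[of E S]
  proof
    assume "has_butterfly E S"
    then have "has_two_K2 E S" unfolding has_butterfly_def has_two_K2_def by blast
    then show ?R using has_two_K2_join by blast
  next
    assume "has_double_co_P3 E S"
    then obtain x y z x' y' z' where s: "x \<in> S" "y \<in> S" "z \<in> S" "x' \<in> S" "y' \<in> S" "z' \<in> S"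
      and p: "co_P3 E x y z" and p': "co_P3 E x' y' z'"
      and c: "E x x'" "E x y'" "E x z'" "E y x'" "E y y'" "E y z'" "E z x'" "E z y'" "E z z'"
      unfolding has_double_co_P3_def by blast
    obtain i where i: "i \<in> I" "x \<in> A i" "y \<in> A i" "z \<in> A i"
      using co_P3_in_part[OF p] s by blast
    obtain j where j: "j \<in> I" "x' \<in> A j" "y' \<in> A j" "z' \<in> A j"
      using co_P3_in_part[OF p'] s by blast
    show ?R
    proof (cases "i = j")
      case True
      then have "has_double_co_P3 E (A i)"
        unfolding has_double_co_P3_def using i j p p' c by blast
      then show ?thesis using i unfolding forbidden_def by blast
    next
      case False
      have "has_co_P3 E (A i)" "has_co_P3 E (A j)"
        unfolding has_co_P3_def using i j p p' by blast+
      then show ?thesis using i j False by blast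
    qed
  qed
next
  assume ?R
  then show "forbidden E S"
  proof (elim disjE)
    show "\<exists>i\<in>I. forbidden E (A i) \<Longrightarrow> forbidden E S" using mono_parts(4) by blast
  next
    assume "\<exists>i\<in>I. has_two_K2 E (A i)"
    then obtain i a b c d where i: "i \<in> I" "a \<in> A i" "b \<in> A i" "c \<in> A i" "d \<in> A i"
      and p: "two_K2 E a b c d" unfolding has_two_K2_def by blast
    obtain j z where j: "j \<in> I" "j \<noteq> i" "z \<in> A j" using two[OF i(1)] by blast
    have "a \<in> S" "b \<in> S" "c \<in> S" "d \<in> S" "z \<in> S" using i j by blast+
    moreover have "E a z" "E b z" "E c z" "E d z" using together[of i j _ z] i j by blast+
    ultimately have "has_butterfly E S" unfolding has_butterfly_def using p by blast
    then show ?thesis by (simp add: forbidden_def)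
  next
    assume "\<exists>i\<in>I. \<exists>j\<in>I. i \<noteq> j \<and> has_co_P3 E (A i) \<and> has_co_P3 E (A j)"
    then obtain i j x y z x' y' z' where ij: "i \<in> I" "j \<in> I" "i \<noteq> j"
      and i: "x \<in> A i" "y \<in> A i" "z \<in> A i" "co_P3 E x y z"
      and j: "x' \<in> A j" "y' \<in> A j" "z' \<in> A j" "co_P3 E x' y' z'"
      unfolding has_co_P3_def by blast
    have "x \<in> S" "y \<in> S" "z \<in> S" "x' \<in> S" "y' \<in> S" "z' \<in> S" using ij i j by blast+
    moreover have "E p q" if "p \<in> A i" "q \<in> A j" for p q using together[OF ij that] .
    ultimately have "has_double_co_P3 E S"
      unfolding has_double_co_P3_def using i j by meson
    then show ?thesis by (simp add: forbidden_def)
  qed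
qed

end

section \<open>The flags computed by the algorithm\<close>

lemma val_tick [simp]: "val (tick x) = x" and cost_tick [simp]: "cost (tick x) = 1"
  by (simp_all add: tick_def)

lemma val_bind [simp]: "val (bind_tm s f) = val (f (val s))"
  and cost_bind [simp]: "cost (bind_tm s f) = cost s + cost (f (val s))"
  by (simp_all add: bind_tm_def)

lemma val_any_flag [simp]: "val (any_flag p fs) \<longleftrightarrow> (\<exists>f\<in>set fs. p f)"
  by (induction fs) auto

lemma cost_any_flag [simp]: "cost (any_flag p fs) = length fs + 1"
  by (induction fs) auto

lemma val_count_flag [simp]: "val (count_flag p fs) = length (filter p fs)"
  by (induction fs) auto

lemma cost_count_flag [simp]: "cost (count_flag p fs) = length fs + 1"
  by (induction fs) auto

lemma two_le_length_filter:
  "2 \<le> length (filter p xs) \<longleftrightarrow>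
     (\<exists>i\<in>{..<length xs}. \<exists>j\<in>{..<length xs}. i \<noteq> j \<and> p (xs ! i) \<and> p (xs ! j))"
proof -
  let ?I = "{i. i < length xs \<and> p (xs ! i)}"
  have "finite ?I" by simp
  then have "card ?I \<le> Suc 0 \<longleftrightarrow> (\<forall>i\<in>?I. \<forall>j\<in>?I. i = j)"
    by (rule card_le_Suc0_iff_eq)
  moreover have "2 \<le> card ?I \<longleftrightarrow> \<not> card ?I \<le> Suc 0" by auto
  ultimately have "2 \<le> card ?I \<longleftrightarrow> (\<exists>i\<in>?I. \<exists>j\<in>?I. i \<noteq> j)" by blast
  then show ?thesis unfolding length_filter_conv_card by auto
qed

lemma val_process_children:
  assumes "\<And>c. c \<in> set cs \<Longrightarrow> val (process c) = (if bad c then None else Some (g c))"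
  shows "val (process_children cs) = (if \<exists>c\<in>set cs. bad c then None else Some (map g cs))"
  using assms by (induction cs) auto

definition flags_of :: "('a \<Rightarrow> 'a \<Rightarrow> bool) \<Rightarrow> 'a set \<Rightarrow> flags" where
  "flags_of E S = Flags (has_edge E S) (has_co_P3 E S) (has_two_K2 E S)"

text \<open>
  What a reduced cotree of \<open>G\<close> satisfies and each of its subtrees inherits: the leaves need not
  exhaust the vertices of \<open>G\<close>.
\<close>

definition nodes_ok :: "'a graph \<Rightarrow> 'a cotree \<Rightarrow> bool" where
  "nodes_ok G T \<longleftrightarrow> distinct (leaves T) \<and> (\<forall>u \<in> nodes T. case u of
        Leaf v \<Rightarrow> True
      | UnionNode cs \<Rightarrow> 2 \<le> length cs \<and> node_graph G u = graph_union (map (node_graph G) cs)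
      | JoinNode cs \<Rightarrow> 2 \<le> length cs \<and> node_graph G u = graph_join (map (node_graph G) cs))"

lemma nodes_ok_if_reduced: "cotree_of G T \<Longrightarrow> reduced T \<Longrightarrow> nodes_ok G T"
  unfolding cotree_of_def reduced_def nodes_ok_def by (simp split: cotree.splits)

lemma distinct_concat_map_nth:
  "distinct (concat (map f cs)) \<Longrightarrow> i < length cs \<Longrightarrow> j < length cs \<Longrightarrow>
     x \<in> set (f (cs ! i)) \<Longrightarrow> x \<in> set (f (cs ! j)) \<Longrightarrow> i = j"
proof (induction cs arbitrary: i j)
  case (Cons c cs)
  have disj: "x \<notin> set (f (cs ! k))" if "x \<in> set (f c)" "k < length cs" for k
  proof -
    have "set (f c) \<inter> (\<Union>a\<in>set cs. set (f a)) = {}" using Cons.prems(1) by simp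
    then show ?thesis using that(1) nth_mem[OF that(2)] by blast
  qed
  show ?case
    using Cons.prems Cons.IH disj by (cases i; cases j) auto
qed simp

lemma distinct_concat_mapD: "distinct (concat (map f cs)) \<Longrightarrow> c \<in> set cs \<Longrightarrow> distinct (f c)"
  by (induction cs) auto

lemma nodes_ok_UnionNode:
  assumes "nodes_ok G (UnionNode cs)"
  shows "2 \<le> length cs" "\<And>c. c \<in> set cs \<Longrightarrow> nodes_ok G c"
    "node_graph G (UnionNode cs) = graph_union (map (node_graph G) cs)"
    "distinct (concat (map leaves cs))"
proof -
  show "distinct (concat (map leaves cs))" using assms by (simp add: nodes_ok_def)
  then show "nodes_ok G c" if "c \<in> set cs" for c
    using assms that distinct_concat_mapD[of leaves cs c] by (simp add: nodes_ok_def)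
qed (use assms in \<open>simp_all add: nodes_ok_def\<close>)

lemma nodes_ok_JoinNode:
  assumes "nodes_ok G (JoinNode cs)"
  shows "2 \<le> length cs" "\<And>c. c \<in> set cs \<Longrightarrow> nodes_ok G c"
    "node_graph G (JoinNode cs) = graph_join (map (node_graph G) cs)"
    "distinct (concat (map leaves cs))"
proof -
  show "distinct (concat (map leaves cs))" using assms by (simp add: nodes_ok_def)
  then show "nodes_ok G c" if "c \<in> set cs" for c
    using assms that distinct_concat_mapD[of leaves cs c] by (simp add: nodes_ok_def)
qed (use assms in \<open>simp_all add: nodes_ok_def\<close>)

lemma leaves_nonempty: "nodes_ok G T \<Longrightarrow> leaves T \<noteq> []"
proof (induction T)
  case (UnionNode cs)
  note ok = nodes_ok_UnionNode[OF UnionNode.prems]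
  have "hd cs \<in> set cs" using ok(1) by (cases cs) auto
  then show ?case using UnionNode.IH[of "hd cs"] ok(2)[of "hd cs"] by auto
next
  case (JoinNode cs)
  note ok = nodes_ok_JoinNode[OF JoinNode.prems]
  have "hd cs \<in> set cs" using ok(1) by (cases cs) auto
  then show ?case using JoinNode.IH[of "hd cs"] ok(2)[of "hd cs"] by auto
qed simp

lemma node_graph_union_apart:
  assumes U: "node_graph G (UnionNode cs) = graph_union (map (node_graph G) cs)"
    and d: "distinct (concat (map leaves cs))"
    and ij: "i < length cs" "j < length cs" "i \<noteq> j"
    and x: "x \<in> set (leaves (cs ! i))" and y: "y \<in> set (leaves (cs ! j))"
  shows "\<not> adj G x y"
proof
  assume "adj G x y"
  have "cs ! i \<in> set cs" "cs ! j \<in> set cs" using ij by simp_all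
  then have "x \<in> set (leaves (UnionNode cs))" "y \<in> set (leaves (UnionNode cs))"
    using x y by auto
  with \<open>adj G x y\<close> have "{x, y} \<in> edges (node_graph G (UnionNode cs))"
    unfolding node_graph_def induced_def adj_def by auto
  then have "\<exists>c\<in>set cs. {x, y} \<in> edges (node_graph G c)"
    unfolding U graph_union_def by auto
  then obtain c where "c \<in> set cs" "x \<in> set (leaves c)" "y \<in> set (leaves c)"
    unfolding node_graph_def induced_def by auto
  then obtain k where "k < length cs" "x \<in> set (leaves (cs ! k))" "y \<in> set (leaves (cs ! k))"
    by (metis in_set_conv_nth)
  then have "i = k" "j = k" using distinct_concat_map_nth[OF d] ij(1,2) x y by blast+
  then show False using ij(3) by simp
qed

lemma node_graph_join_together:
  assumes J: "node_graph G (JoinNode cs) = graph_join (map (node_graph G) cs)"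
    and ij: "i < length cs" "j < length cs" "i \<noteq> j"
    and x: "x \<in> set (leaves (cs ! i))" and y: "y \<in> set (leaves (cs ! j))"
  shows "adj G x y"
proof -
  have "x \<in> verts (map (node_graph G) cs ! i)" "y \<in> verts (map (node_graph G) cs ! j)"
    using ij x y by (simp_all add: node_graph_def)
  moreover have "i < length (map (node_graph G) cs)" "j < length (map (node_graph G) cs)"
    using ij by simp_all
  ultimately have "{x, y} \<in> edges (graph_join (map (node_graph G) cs))"
    unfolding graph_join_def graph.simps
    by (intro UnI2 CollectI exI[of _ x] exI[of _ y] exI[of _ i] exI[of _ j]) (use ij(3) in simp)
  then show ?thesis unfolding J[symmetric] by (simp add: node_graph_def induced_def adj_def)
qed

lemma bex_set_nth: "(\<exists>c\<in>set cs. P c) \<longleftrightarrow> (\<exists>i\<in>{..<length cs}. P (cs ! i))"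
  by (metis in_set_conv_nth lessThan_iff)

lemma UN_set_nth: "(\<Union>c\<in>set cs. f c) = (\<Union>i\<in>{..<length cs}. f (cs ! i))"
  by (simp add: set_eq_iff bex_set_nth)

lemma other_child:
  assumes "2 \<le> length cs" "\<And>c. c \<in> set cs \<Longrightarrow> nodes_ok G c"
  shows "\<exists>j\<in>{..<length cs}. j \<noteq> i \<and> set (leaves (cs ! j)) \<noteq> {}"
proof -
  obtain j where j: "j < length cs" "j \<noteq> i"
  proof (cases "i = 0")
    case True
    then show ?thesis using that[of 1] assms(1) by simp
  next
    case False
    then show ?thesis using that[of 0] assms(1) by fastforce
  qed
  then have "set (leaves (cs ! j)) \<noteq> {}" using leaves_nonempty[OF assms(2)[OF nth_mem]] by simp
  then show ?thesis using j by blast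
qed

theorem process_correct:
  assumes G: "simple_graph G"
  shows "nodes_ok G T \<Longrightarrow> val (process T) =
    (if forbidden (adj G) (set (leaves T)) then None
     else Some (flags_of (adj G) (set (leaves T))))"
proof (induction T)
  case (Leaf v)
  then show ?case
    using adj_irrefl[OF G]
    by (simp add: forbidden_def flags_of_def has_butterfly_def has_double_co_P3_def has_edge_def
        has_co_P3_def has_two_K2_def co_P3_def two_K2_def)
next
  case (UnionNode cs)
  note ok = nodes_ok_UnionNode[OF UnionNode.prems]
  let ?S = "set (leaves (UnionNode cs))" and ?A = "\<lambda>i. set (leaves (cs ! i))"
    and ?I = "{..<length cs}"
  interpret union_parts "adj G" ?I ?A
    using adj_sym node_graph_union_apart[OF ok(3,4)] by unfold_locales auto
  have S: "?S = (\<Union>i\<in>?I. ?A i)" using UN_set_nth[of "\<lambda>c. set (leaves c)" cs] by simp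
  have children: "val (process_children cs) =
      (if \<exists>c\<in>set cs. forbidden (adj G) (set (leaves c)) then None
       else Some (map (\<lambda>c. flags_of (adj G) (set (leaves c))) cs))"
    using UnionNode.IH ok(2) by (intro val_process_children) blast
  have co_P3: "has_co_P3 (adj G) S \<longleftrightarrow> (\<exists>i\<in>?I. has_co_P3 (adj G) (?A i)) \<or> has_edge (adj G) S"
    using other_child[OF ok(1,2)] by (intro has_co_P3_union) blast
  have "val (union_step (map (\<lambda>c. flags_of (adj G) (set (leaves c))) cs)) = flags_of (adj G) ?S"
    unfolding S flags_of_def[of _ "\<Union>(?A ` ?I)"] co_P3 has_two_K2_union has_edge_union
    by (simp add: union_step_def filter_map comp_def two_le_length_filter flags_of_def bex_set_nth)
  moreover have "forbidden (adj G) ?S \<longleftrightarrow> (\<exists>c\<in>set cs. forbidden (adj G) (set (leaves c)))"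
    unfolding S forbidden_union by (simp add: bex_set_nth)
  ultimately show ?case using children by auto
next
  case (JoinNode cs)
  note ok = nodes_ok_JoinNode[OF JoinNode.prems]
  let ?S = "set (leaves (JoinNode cs))" and ?A = "\<lambda>i. set (leaves (cs ! i))"
    and ?I = "{..<length cs}" and ?fs = "map (\<lambda>c. flags_of (adj G) (set (leaves c))) cs"
  interpret join_parts "adj G" ?I ?A
  proof
    show "?A i \<noteq> {}" if "i \<in> ?I" for i
      using leaves_nonempty[OF ok(2)[OF nth_mem]] that by simp
    show "?I \<noteq> {}" using ok(1) by (auto simp: lessThan_empty_iff)
  qed (use adj_sym node_graph_join_together[OF ok(3)] other_child[OF ok(1,2)] in auto)
  have S: "?S = (\<Union>i\<in>?I. ?A i)" using UN_set_nth[of "\<lambda>c. set (leaves c)" cs] by simp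
  have children: "val (process_children cs) =
      (if \<exists>c\<in>set cs. forbidden (adj G) (set (leaves c)) then None else Some ?fs)"
    using JoinNode.IH ok(2) by (intro val_process_children) blast
  have bad: "forbidden (adj G) ?S \<longleftrightarrow> (\<exists>c\<in>set cs. forbidden (adj G) (set (leaves c))) \<or>
      (\<exists>f\<in>set ?fs. b_flag f) \<or> 2 \<le> length (filter a_flag ?fs)"
    unfolding S forbidden_join
    by (simp add: filter_map comp_def two_le_length_filter flags_of_def bex_set_nth)
  have good: "flags_of (adj G) ?S = Flags True (\<exists>f\<in>set ?fs. a_flag f) (\<exists>f\<in>set ?fs. b_flag f)"
    unfolding S flags_of_def[of _ "\<Union>(?A ` ?I)"] has_co_P3_join has_two_K2_join
    using has_edge_join by (simp add: flags_of_def bex_set_nth)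
  have "val (join_step ?fs) =
      (if (\<exists>f\<in>set ?fs. b_flag f) \<or> 2 \<le> length (filter a_flag ?fs) then None
       else Some (flags_of (adj G) ?S))"
    unfolding good join_step_def by simp
  then show ?case unfolding bad using children by auto
qed

section \<open>Running time\<close>

lemma cost_union_step: "cost (union_step fs) = 4 * length fs + 5"
  by (simp add: union_step_def)

lemma cost_join_step: "cost (join_step fs) \<le> 4 * length fs + 5"
  by (simp add: join_step_def)

lemma cost_process_children:
  "cost (process_children cs) \<le> (\<Sum>c\<leftarrow>cs. cost (process c)) + length cs + 1"
  by (induction cs) (auto split: option.splits)

lemma length_process_children: "val (process_children cs) = Some fs \<Longrightarrow> length fs = length cs"
  by (induction cs arbitrary: fs) (auto split: option.splits)

text \<open>
  An internal node with \<open>k\<close> children costs at most \<open>5k + 7\<close> steps on top of its subtrees. The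
  constant 17 is the least credit that, saved at each of the \<open>k \<ge> 2\<close> children, pays for this and
  for the credit of the node itself: \<open>5k + 7 + 17 \<le> 17k\<close>. A leaf takes one step and saves
  its own credit, which accounts for the 18.
\<close>

lemma process_cost: "nodes_ok G T \<Longrightarrow> cost (process T) + 17 \<le> 18 * length (leaves T)"
proof -
  have node: "(\<Sum>c\<leftarrow>cs. cost (process c)) + (5 * length cs + 7) + 17 \<le> 18 * length (concat (map leaves cs))"
    if two: "2 \<le> length cs"
      and IH: "\<And>c. c \<in> set cs \<Longrightarrow> cost (process c) + 17 \<le> 18 * length (leaves c)"
    for cs :: "'a cotree list"
  proof -
    have "(\<Sum>c\<leftarrow>cs. cost (process c)) + 17 * length cs \<le> 18 * length (concat (map leaves cs))"
      using IH
    proof (induction cs)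
      case (Cons c cs)
      have "cost (process c) + 17 \<le> 18 * length (leaves c)" using Cons.prems by simp
      moreover have "(\<Sum>c\<leftarrow>cs. cost (process c)) + 17 * length cs
          \<le> 18 * length (concat (map leaves cs))"
        using Cons by simp
      ultimately show ?case by simp
    qed simp
    then show ?thesis using two by linarith
  qed
  show "nodes_ok G T \<Longrightarrow> ?thesis"
  proof (induction T)
    case (UnionNode cs)
    note ok = nodes_ok_UnionNode[OF UnionNode.prems]
    have "cost (process (UnionNode cs)) \<le> (\<Sum>c\<leftarrow>cs. cost (process c)) + (5 * length cs + 7)"
      using cost_process_children[of cs] length_process_children[of cs]
      by (auto simp: cost_union_step split: option.splits)
    then show ?case using node[OF ok(1)] UnionNode.IH ok(2) by fastforce
  next
    case (JoinNode cs)
    note ok = nodes_ok_JoinNode[OF JoinNode.prems]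
    have "cost (process (JoinNode cs)) \<le> (\<Sum>c\<leftarrow>cs. cost (process c)) + (5 * length cs + 7)"
    proof (cases "val (process_children cs)")
      case None
      then show ?thesis using cost_process_children[of cs] by simp
    next
      case (Some fs)
      then show ?thesis
        using cost_process_children[of cs] length_process_children[OF Some] cost_join_step[of fs]
        by simp
    qed
    then show ?case using node[OF ok(1)] JoinNode.IH ok(2) by fastforce
  qed simp
qed

theorem proposition11:
  fixes construct :: "'a graph \<Rightarrow> 'a cotree option tm"
  assumes "constructs_cotrees construct"
    and "linear_time construct"
  shows "(\<forall>G. simple_graph G \<longrightarrow>
            val (recognition construct G) = (if perfectly_well_ve_dominated G then YES else NO)) \<and>
         linear_time (recognition construct)"
proof
  have no_tree: "val (construct G) = None" if "simple_graph G" "\<not> cograph G" for G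
    using assms(1) that unfolding constructs_cotrees_def by simp
  have tree: "\<exists>T. val (construct G) = Some T \<and> nodes_ok G T \<and> set (leaves T) = verts G"
    if "simple_graph G" "cograph G" for G
  proof -
    have "\<exists>T. val (construct G) = Some T \<and> cotree_of G T \<and> reduced T"
      using assms(1) that unfolding constructs_cotrees_def by presburger
    then show ?thesis using nodes_ok_if_reduced unfolding cotree_of_def by blast
  qed
  show "\<forall>G. simple_graph G \<longrightarrow>
      val (recognition construct G) = (if perfectly_well_ve_dominated G then YES else NO)"
  proof (intro allI impI)
    fix G :: "'a graph" assume G: "simple_graph G"
    show "val (recognition construct G) = (if perfectly_well_ve_dominated G then YES else NO)"
    proof (cases "cograph G")
      case True
      then show ?thesis
        using tree[OF G] process_correct[OF G]
        by (auto simp: recognition_def perfectly_well_ve_dominated_iff[OF G])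
    next
      case False
      then show ?thesis
        using no_tree[OF G] by (simp add: recognition_def perfectly_well_ve_dominated_iff[OF G])
    qed
  qed
  obtain K where K: "\<And>G. simple_graph G \<Longrightarrow> cost (construct G) \<le> K * (card (verts G) + card (edges G))"
    using assms(2) unfolding linear_time_def by blast
  have "cost (recognition construct G) \<le> (K + 18) * (card (verts G) + card (edges G))"
    if G: "simple_graph G" for G
  proof -
    have n: "1 \<le> card (verts G)"
      using G unfolding simple_graph_def by (simp add: Suc_leI card_gt_0_iff)
    have "cost (recognition construct G) \<le> cost (construct G) + 18 * card (verts G)"
    proof (cases "val (construct G)")
      case None
      then show ?thesis using n by (simp add: recognition_def)
    next
      case (Some T)
      then have T: "nodes_ok G T" "set (leaves T) = verts G"
        using tree[OF G] no_tree[OF G] by fastforce+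
      then have "length (leaves T) = card (verts G)"
        unfolding nodes_ok_def by (metis distinct_card)
      then have "cost (process T) + 17 \<le> 18 * card (verts G)" using process_cost[OF T(1)] by simp
      then show ?thesis using Some by (simp add: recognition_def split: option.split)
    qed
    then show ?thesis using K[OF G] by (simp add: algebra_simps)
  qed
  then show "linear_time (recognition construct)" unfolding linear_time_def by blast
qed

end
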